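(* Let $G_S$ be a connected self-loop graph of order $n$ and size $m$, with $|S|=\sigma$, where $G$ is the underlying finite simple graph and $S\subseteq V(G)$. Let $\lambda_1(G_S)$ be the spectral radius of $G_S$, and let $M_1(G)$ and $\delta(G)$ be the first Zagreb index and the minimum degree of $G$, respectively. Then $$\lambda_1(G_S) \geq \sqrt{\frac{M_1(G)}{n} + \frac{\sigma}{n}\,(2\delta(G)+1)}.$$ In particular, equality holds when (i) $G_S \cong \widehat{K_n}$, or (ii) $G$ is a $(k,k+1)$-semiregular graph such that $d_G(v)=k$ if $v\in S$ and $d_G(v)=k+1$ if $v \in V(G)\setminus S$.
   Context: $d_G(v)$ is the degree of $v$ in $G$. The self-loop graph $G_S$ is obtained from $G$ by attaching one loop at each vertex of $S$; its adjacency matrix is $A(G_S)=A(G)+\mathfrak{I}_S$, where $\mathfrak{I}_S$ is the diagonal $0/1$ matrix with ones exactly at the positions corresponding to $S$, and $\lambda_1(G_S)$ is the largest eigenvalue of $A(G_S)$. The size $m$ is the number of edges of $G$ (loops are not counted). The first Zagreb index is $M_1(G)=\sum_{v\in V(G)} d_G(v)^2$. $\widehat{K_n}$ is the complete graph $K_n$ with a loop attached at every vertex. A graph is $(r,k)$-bidegreed if every vertex has degree $r$ or $k$; it is $(r,k)$-semiregular if it is bipartite and $(r,k)$-bidegreed. *)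

theory Defs
  imports
    "Graph_Theory.Digraph_Isomorphism"
    "Graph_Theory.Pair_Digraph"
    "Jordan_Normal_Form.Spectral_Radius"
begin

(* Finite simple graphs are the symmetric loop-free finite digraphs of the locale pair_graph:
   an edge uv is the pair of arcs (u,v), (v,u).  Hence the degree of a vertex is its out-degree. *)

definition vdeg :: "'a pair_pre_digraph \<Rightarrow> 'a \<Rightarrow> nat" where
  "vdeg G v = out_degree (with_proj G) v"

definition num_edges :: "'a pair_pre_digraph \<Rightarrow> nat" where
  "num_edges G = card {{u, v} | u v. (u, v) \<in> parcs G}"

definition first_zagreb :: "'a pair_pre_digraph \<Rightarrow> nat" where
  "first_zagreb G = (\<Sum>v\<in>pverts G. (vdeg G v)\<^sup>2)"

definition min_degree :: "'a pair_pre_digraph \<Rightarrow> nat" where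
  "min_degree G = Min (vdeg G ` pverts G)"

definition bipartite :: "'a pair_pre_digraph \<Rightarrow> bool" where
  "bipartite G \<longleftrightarrow> (\<exists>U W. pverts G = U \<union> W \<and> U \<inter> W = {} \<and> parcs G \<subseteq> U \<times> W \<union> W \<times> U)"

definition bidegreed :: "nat \<Rightarrow> nat \<Rightarrow> 'a pair_pre_digraph \<Rightarrow> bool" where
  "bidegreed r k G \<longleftrightarrow> (\<forall>v\<in>pverts G. vdeg G v = r \<or> vdeg G v = k)"

definition semiregular :: "nat \<Rightarrow> nat \<Rightarrow> 'a pair_pre_digraph \<Rightarrow> bool" where
  "semiregular r k G \<longleftrightarrow> bipartite G \<and> bidegreed r k G"

definition self_loop_graph :: "'a pair_pre_digraph \<Rightarrow> 'a set \<Rightarrow> 'a pair_pre_digraph" where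
  "self_loop_graph G S = \<lparr> pverts = pverts G, parcs = parcs G \<union> {(v, v) | v. v \<in> S} \<rparr>"

definition complete_graph :: "nat \<Rightarrow> nat pair_pre_digraph" where
  "complete_graph n =
     \<lparr> pverts = {..<n}, parcs = {(u, v). u \<in> {..<n} \<and> v \<in> {..<n} \<and> u \<noteq> v} \<rparr>"

definition looped_complete_graph :: "nat \<Rightarrow> nat pair_pre_digraph" where
  "looped_complete_graph n = self_loop_graph (complete_graph n) {..<n}"

(* Matrices are indexed by {0..<n}, so they are taken with respect to an enumeration vs of the
   vertices (a list with distinct vs and set vs = pverts G).  A different enumeration conjugates
   them by a permutation matrix, which does not affect the spectrum. *)

definition adj_mat :: "'a list \<Rightarrow> 'a pair_pre_digraph \<Rightarrow> real mat" where
  "adj_mat vs H = mat (length vs) (length vs)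
     (\<lambda>(i, j). if (vs ! i, vs ! j) \<in> parcs H then 1 else 0)"

definition loop_mat :: "'a list \<Rightarrow> 'a set \<Rightarrow> real mat" where
  "loop_mat vs S = mat (length vs) (length vs)
     (\<lambda>(i, j). if i = j \<and> vs ! i \<in> S then 1 else 0)"

definition self_loop_adj_mat :: "'a list \<Rightarrow> 'a pair_pre_digraph \<Rightarrow> 'a set \<Rightarrow> real mat" where
  "self_loop_adj_mat vs G S = adj_mat vs G + loop_mat vs S"

lemma self_loop_adj_mat_eq:
  assumes "pair_graph G" "distinct vs"
  shows "self_loop_adj_mat vs G S = adj_mat vs (self_loop_graph G S)"
proof -
  interpret pair_graph G by fact
  have "(v, v) \<notin> parcs G" for v
    using pair_no_loops by force
  then show ?thesis
    using assms(2)
    by (intro eq_matI)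
      (auto simp: self_loop_adj_mat_def adj_mat_def loop_mat_def self_loop_graph_def
        nth_eq_iff_index_eq)
qed

(* The matrix is real symmetric, so its real spectrum is the whole spectrum. *)
definition lambda1 :: "'a list \<Rightarrow> 'a pair_pre_digraph \<Rightarrow> 'a set \<Rightarrow> real" where
  "lambda1 vs G S = Max (spectrum (self_loop_adj_mat vs G S))"

end

(* A maximizer of the Rayleigh quotient of the symmetric matrix A on the unit sphere is an
   eigenvector, with eigenvalue mu say.  Since A has nonnegative entries, replacing y by |y| gives
   |<y, A y>| <= mu |y|^2, and polarization turns this into |A y| <= mu |y|.  For y the all-ones
   vector, A y has entries d(v) + [v in S], whose squares sum to
   M_1 + sum_{v in S} (2 d(v) + 1) >= M_1 + sigma (2 delta + 1).
   In both equality cases d(v) + [v in S] is a constant r and S consists of vertices of minimum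
   degree; then the bound equals r, and no eigenvalue exceeds the common row sum r. *)

theory Submission
  imports "HOL-Analysis.Function_Topology" Defs
begin

section \<open>Symmetric bilinear forms on a finite index set\<close>

text \<open>This is the form x^T a y. Vectors are plain functions of which only the values on
  \<open>I\<close> count, so that compactness can be taken from the product topology on
  functions.\<close>

definition bilin :: "'i set \<Rightarrow> ('i \<Rightarrow> 'i \<Rightarrow> real) \<Rightarrow> ('i \<Rightarrow> real) \<Rightarrow> ('i \<Rightarrow> real) \<Rightarrow> real" where
  "bilin I a x y = (\<Sum>i\<in>I. x i * (\<Sum>j\<in>I. a i j * y j))"

lemma bilin_scale: "bilin I a (\<lambda>i. c * x i) (\<lambda>i. c * x i) = c\<^sup>2 * bilin I a x x"
  unfolding bilin_def sum_distrib_left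
  by (intro sum.cong refl) (simp add: power2_eq_square algebra_simps)

lemma bilin_commute:
  assumes "\<And>i j. i \<in> I \<Longrightarrow> j \<in> I \<Longrightarrow> a i j = a j i"
  shows "bilin I a x y = bilin I a y x"
proof -
  have "bilin I a x y = (\<Sum>i\<in>I. \<Sum>j\<in>I. x i * a i j * y j)"
    unfolding bilin_def by (simp add: sum_distrib_left mult.assoc)
  also have "\<dots> = (\<Sum>j\<in>I. \<Sum>i\<in>I. x i * a i j * y j)"
    by (rule sum.swap)
  also have "\<dots> = bilin I a y x"
    unfolding bilin_def sum_distrib_left
    by (intro sum.cong refl) (simp add: assms)
  finally show ?thesis .
qed

text \<open>Serves two purposes: perturbing a maximizer along a direction, and polarization by
  subtracting the expansions for opposite scales.\<close>

lemma bilin_line: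
  assumes "\<And>i j. i \<in> I \<Longrightarrow> j \<in> I \<Longrightarrow> a i j = a j i"
  shows "bilin I a (\<lambda>i. x i + t * y i) (\<lambda>i. x i + t * y i)
    = bilin I a x x + 2 * t * bilin I a y x + t\<^sup>2 * bilin I a y y"
proof -
  have "bilin I a (\<lambda>i. x i + t * y i) (\<lambda>i. x i + t * y i)
    = bilin I a x x + t * bilin I a x y + t * bilin I a y x + t\<^sup>2 * bilin I a y y"
    unfolding bilin_def sum_distrib_left sum.distrib[symmetric]
    by (intro sum.cong refl) (simp add: power2_eq_square algebra_simps)
  then show ?thesis
    using bilin_commute[of I a x y] assms by simp
qed

lemma sum_power2_line:
  fixes x y :: "'i \<Rightarrow> real"
  shows "(\<Sum>i\<in>I. (x i + t * y i)\<^sup>2)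
    = (\<Sum>i\<in>I. (x i)\<^sup>2) + 2 * t * (\<Sum>i\<in>I. y i * x i) + t\<^sup>2 * (\<Sum>i\<in>I. (y i)\<^sup>2)"
  unfolding sum_distrib_left sum.distrib[symmetric]
  by (intro sum.cong refl) (simp add: power2_eq_square algebra_simps)

text \<open>First-order condition for a minimum at \<open>t = 0\<close>, obtained without
  derivatives: a nonzero slope would make the quadratic negative for a suitable small
  \<open>t\<close>.\<close>

lemma linear_coeff_eq_0_of_nonneg_quadratic:
  fixes b c :: real
  assumes "\<And>t. 0 \<le> 2 * t * b + t\<^sup>2 * c" "0 \<le> c"
  shows "b = 0"
proof -
  \<comment> \<open>The minimizer would be \<open>- b / c\<close>; the denominator
    \<open>c + 1\<close> also covers \<open>c = 0\<close> and still turns the quadratic into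
    \<open>- (t\<^sup>2 * (c + 2))\<close>.\<close>
  define t where "t = - b / (c + 1)"
  have b: "b = - (t * (c + 1))"
    using assms(2) by (simp add: t_def)
  have "0 \<le> - (t\<^sup>2 * (c + 2))"
    using assms(1)[of t] unfolding b by (simp add: power2_eq_square algebra_simps)
  then have "t = 0"
    using assms(2) by (simp add: mult_le_0_iff)
  then show ?thesis
    using b by simp
qed

section \<open>Maximizers of the Rayleigh quotient\<close>

text \<open>Pinning the coordinates outside \<open>I\<close> to 0 places the sphere in a product of
  intervals and singletons, which is compact by Tychonoff; the norm equation cuts out a closed
  set.\<close>

lemma compact_unit_sphere_fun:
  fixes I :: "'i set"
  assumes "finite I"
  shows "compact {x :: 'i \<Rightarrow> real. (\<forall>i. i \<notin> I \<longrightarrow> x i = 0) \<and> (\<Sum>i\<in>I. (x i)\<^sup>2) = 1}"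
proof -
  let ?B = "PiE UNIV (\<lambda>i. if i \<in> I then {-1..1} else {0}) :: ('i \<Rightarrow> real) set"
  let ?C = "{x :: 'i \<Rightarrow> real. (\<Sum>i\<in>I. (x i)\<^sup>2) = 1}"
  have "compactin (product_topology (\<lambda>_. euclidean) UNIV) ?B"
    by (subst compactin_PiE) auto
  then have "compact ?B"
    by (simp add: euclidean_product_topology)
  moreover have "closed ?C"
    by (intro closed_Collect_eq continuous_intros continuous_on_product_coordinates)
  ultimately have "compact (?B \<inter> ?C)"
    by (rule compact_Int_closed)
  moreover have "{x. (\<forall>i. i \<notin> I \<longrightarrow> x i = 0) \<and> (\<Sum>i\<in>I. (x i)\<^sup>2) = 1} = ?B \<inter> ?C"
  proof -
    have "-1 \<le> x i \<and> x i \<le> 1" if "(\<Sum>i\<in>I. (x i)\<^sup>2) = 1" "i \<in> I" for x :: "'i \<Rightarrow> real" and i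
    proof -
      have "(x i)\<^sup>2 \<le> (\<Sum>i\<in>I. (x i)\<^sup>2)"
        using assms that by (intro member_le_sum) auto
      then have "\<bar>x i\<bar> \<le> 1"
        using that by (simp add: abs_square_le_1)
      then show ?thesis by linarith
    qed
    then show ?thesis
      by (auto simp: PiE_iff split: if_splits)
  qed
  ultimately show ?thesis by simp
qed

lemma maximal_rayleigh_eigenvector:
  fixes a :: "'i \<Rightarrow> 'i \<Rightarrow> real"
  assumes "finite I" "I \<noteq> {}"
    and sym: "\<And>i j. i \<in> I \<Longrightarrow> j \<in> I \<Longrightarrow> a i j = a j i"
  shows "\<exists>x \<mu>. (\<Sum>i\<in>I. (x i)\<^sup>2) = 1
    \<and> (\<forall>i\<in>I. (\<Sum>j\<in>I. a i j * x j) = \<mu> * x i)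
    \<and> (\<forall>y. bilin I a y y \<le> \<mu> * (\<Sum>i\<in>I. (y i)\<^sup>2))"
proof -
  let ?N = "\<lambda>x :: 'i \<Rightarrow> real. \<Sum>i\<in>I. (x i)\<^sup>2"
  define K where "K = {x :: 'i \<Rightarrow> real. (\<forall>i. i \<notin> I \<longrightarrow> x i = 0) \<and> ?N x = 1}"
  obtain i0 where i0: "i0 \<in> I" using assms by blast
  \<comment> \<open>A unit coordinate vector shows that the sphere is nonempty.\<close>
  have "?N (\<lambda>i. if i = i0 then 1 else 0) = (\<Sum>i\<in>I. if i = i0 then 1 else 0)"
    by (intro sum.cong) auto
  then have "(\<lambda>i. if i = i0 then 1 else 0) \<in> K"
    using assms i0 by (auto simp: K_def)
  then have "K \<noteq> {}" by blast
  moreover have "continuous_on UNIV (\<lambda>x. bilin I a x x)"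
    unfolding bilin_def
    by (rule continuous_on_sum continuous_on_mult continuous_on_product_coordinates continuous_on_const)+
  then have "continuous_on K (\<lambda>x. bilin I a x x)"
    by (rule continuous_on_subset) simp
  ultimately obtain x where x: "x \<in> K" and max: "\<And>y. y \<in> K \<Longrightarrow> bilin I a y y \<le> bilin I a x x"
    using continuous_attains_sup[of K "\<lambda>x. bilin I a x x"]
      compact_unit_sphere_fun[OF assms(1), folded K_def] by blast
  define \<mu> where "\<mu> = bilin I a x x"
  have Nx: "?N x = 1" using x by (simp add: K_def)
  have le: "bilin I a y y \<le> \<mu> * ?N y" for y
  proof (cases "?N y = 0")
    case True
    then have "\<forall>i\<in>I. y i = 0"
      using assms(1) by (subst (asm) sum_nonneg_eq_0_iff) auto
    then show ?thesis
      using True by (simp add: bilin_def)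
  next
    case False
    then have pos: "?N y > 0"
      by (simp add: order_less_le sum_nonneg)
    let ?c = "1 / sqrt (?N y)"
    \<comment> \<open>Normalization of \<open>y\<close>, cut off outside \<open>I\<close> to be a
      member of \<open>K\<close>; neither the form nor the norm sees the cut.\<close>
    let ?y = "\<lambda>i. if i \<in> I then ?c * y i else 0"
    have c2: "?c\<^sup>2 = 1 / ?N y"
      using pos by (simp add: power_divide)
    have "?N ?y = (\<Sum>i\<in>I. ?c\<^sup>2 * (y i)\<^sup>2)"
      by (intro sum.cong) (auto simp: power_mult_distrib power_divide)
    also have "\<dots> = ?c\<^sup>2 * ?N y"
      by (rule sum_distrib_left[symmetric])
    also have "\<dots> = 1"
      unfolding c2 using pos by simp
    finally have "bilin I a ?y ?y \<le> \<mu>"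
      unfolding \<mu>_def by (intro max) (auto simp: K_def)
    moreover have "bilin I a ?y ?y = bilin I a (\<lambda>i. ?c * y i) (\<lambda>i. ?c * y i)"
      unfolding bilin_def by (intro sum.cong refl arg_cong2[where f = "(*)"]) auto
    ultimately have "bilin I a y y / ?N y \<le> \<mu>"
      unfolding bilin_scale c2 by simp
    then show ?thesis
      using pos by (simp add: pos_divide_le_eq)
  qed
  define r where "r = (\<lambda>i. \<mu> * x i - (\<Sum>j\<in>I. a i j * x j))"
  have br: "\<mu> * (\<Sum>i\<in>I. r i * x i) - bilin I a r x = ?N r"
  proof -
    have "bilin I a r x = (\<Sum>i\<in>I. \<mu> * (r i * x i) - (r i)\<^sup>2)"
      unfolding bilin_def
      by (intro sum.cong refl) (simp add: r_def power2_eq_square algebra_simps)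
    then show ?thesis
      by (simp add: sum_subtractf sum_distrib_left)
  qed
  \<comment> \<open>The form \<open>\<mu> N - bilin\<close> is nonnegative and vanishes at \<open>x\<close>, so its derivative
     there in the direction of the residual \<open>r\<close> is zero; that derivative is \<open>2 N r\<close>.\<close>
  have "?N r = 0"
  proof (rule linear_coeff_eq_0_of_nonneg_quadratic)
    fix t
    have "0 \<le> \<mu> * ?N (\<lambda>i. x i + t * r i) - bilin I a (\<lambda>i. x i + t * r i) (\<lambda>i. x i + t * r i)"
      using le by simp
    also have "\<dots> = 2 * t * (\<mu> * (\<Sum>i\<in>I. r i * x i) - bilin I a r x)
        + t\<^sup>2 * (\<mu> * ?N r - bilin I a r r)"
      by (simp add: sum_power2_line bilin_line[of I a, OF sym] Nx \<mu>_def[symmetric] algebra_simps)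
    finally show "0 \<le> 2 * t * ?N r + t\<^sup>2 * (\<mu> * ?N r - bilin I a r r)"
      unfolding br .
    show "0 \<le> \<mu> * ?N r - bilin I a r r"
      using le[of r] by simp
  qed
  then have "\<forall>i\<in>I. r i = 0"
    using assms(1) by (subst (asm) sum_nonneg_eq_0_iff) auto
  then have "(\<Sum>j\<in>I. a i j * x j) = \<mu> * x i" if "i \<in> I" for i
    using that by (simp add: r_def)
  with Nx le show ?thesis by blast
qed

text \<open>The maximum of the form alone does not exclude eigenvalues far below zero. Nonnegative
  entries do: passing to absolute values bounds the modulus of the form as well, and symmetry then
  yields a bound on the norm of the image vector.\<close>

lemma nonneg_symmetric_norm_bound_eigenvector:
  fixes a :: "'i \<Rightarrow> 'i \<Rightarrow> real"
  assumes "finite I" "I \<noteq> {}"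
    and sym: "\<And>i j. i \<in> I \<Longrightarrow> j \<in> I \<Longrightarrow> a i j = a j i"
    and nonneg: "\<And>i j. i \<in> I \<Longrightarrow> j \<in> I \<Longrightarrow> 0 \<le> a i j"
  shows "\<exists>x \<mu>. (\<Sum>i\<in>I. (x i)\<^sup>2) = 1 \<and> 0 \<le> \<mu>
    \<and> (\<forall>i\<in>I. (\<Sum>j\<in>I. a i j * x j) = \<mu> * x i)
    \<and> (\<forall>y. (\<Sum>i\<in>I. (\<Sum>j\<in>I. a i j * y j)\<^sup>2) \<le> \<mu>\<^sup>2 * (\<Sum>i\<in>I. (y i)\<^sup>2))"
proof -
  let ?N = "\<lambda>x :: 'i \<Rightarrow> real. \<Sum>i\<in>I. (x i)\<^sup>2"
  obtain x \<mu> where Nx: "?N x = 1"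
    and eig: "\<And>i. i \<in> I \<Longrightarrow> (\<Sum>j\<in>I. a i j * x j) = \<mu> * x i"
    and le: "\<And>y. bilin I a y y \<le> \<mu> * ?N y"
    using maximal_rayleigh_eigenvector[of I a, OF assms(1,2) sym] by blast
  have abs_le: "\<bar>bilin I a y y\<bar> \<le> \<mu> * ?N y" for y
  proof -
    have "\<bar>bilin I a y y\<bar> \<le> (\<Sum>i\<in>I. \<Sum>j\<in>I. \<bar>y i * (a i j * y j)\<bar>)"
      unfolding bilin_def sum_distrib_left by (intro order_trans[OF sum_abs] sum_mono sum_abs)
    also have "\<dots> = bilin I a (\<lambda>i. \<bar>y i\<bar>) (\<lambda>i. \<bar>y i\<bar>)"
      unfolding bilin_def sum_distrib_left
      by (intro sum.cong refl) (simp add: abs_mult nonneg)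
    also have "\<dots> \<le> \<mu> * ?N (\<lambda>i. \<bar>y i\<bar>)"
      by (rule le)
    finally show ?thesis by simp
  qed
  have line: "bilin I a (\<lambda>i. u i + s * v i) (\<lambda>i. u i + s * v i)
      = bilin I a u u + 2 * s * bilin I a v u + s\<^sup>2 * bilin I a v v" for s u v
    by (rule bilin_line) (rule sym)
  have \<mu>: "0 \<le> \<mu>"
    using abs_le[of x] Nx by simp
  have "?N (\<lambda>i. \<Sum>j\<in>I. a i j * y j) \<le> \<mu>\<^sup>2 * ?N y" for y
  proof -
    define w where "w = (\<lambda>i. \<Sum>j\<in>I. a i j * y j)"
    have Bw: "bilin I a w y = ?N w"
      by (simp add: bilin_def w_def power2_eq_square)
    \<comment> \<open>polarization with a free scale \<open>t\<close>, to be taken as \<open>1 / \<mu>\<close>\<close>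
    have key: "2 * t * ?N w \<le> \<mu> * (?N y + t\<^sup>2 * ?N w)" for t
    proof -
      have "4 * t * bilin I a w y
          = bilin I a (\<lambda>i. y i + t * w i) (\<lambda>i. y i + t * w i)
            - bilin I a (\<lambda>i. y i + (-t) * w i) (\<lambda>i. y i + (-t) * w i)"
        unfolding line by simp
      also have "\<dots> \<le> \<mu> * ?N (\<lambda>i. y i + t * w i) + \<mu> * ?N (\<lambda>i. y i + (-t) * w i)"
        using abs_le[of "\<lambda>i. y i + t * w i"] abs_le[of "\<lambda>i. y i + (-t) * w i"] by linarith
      \<comment> \<open>Parallelogram law: the cross terms of the two signs cancel.\<close>
      also have "\<dots> = 2 * (\<mu> * (?N y + t\<^sup>2 * ?N w))"
        unfolding sum_power2_line by (simp add: algebra_simps)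
      finally show ?thesis
        unfolding Bw by simp
    qed
    have "?N w \<le> \<mu>\<^sup>2 * ?N y"
    \<comment> \<open>The scale \<open>1 / \<mu>\<close> balances the two terms on the right of
      \<open>key\<close>; for \<open>\<mu> = 0\<close> that right side vanishes for every
      scale.\<close>
    proof (cases "\<mu> = 0")
      case True
      then show ?thesis using key[of 1] by simp
    next
      case False
      then show ?thesis
        using key[of "1 / \<mu>"] \<mu> by (simp add: field_simps power2_eq_square)
    qed
    then show ?thesis by (simp add: w_def)
  qed
  with Nx \<mu> eig show ?thesis by blast
qed

section \<open>Spectrum of nonnegative real matrices\<close>

lemma mult_mat_vec_index_sum:
  assumes "A \<in> carrier_mat n n" "i < n"
  shows "(A *\<^sub>v vec n x) $ i = (\<Sum>j<n. A $$ (i, j) * x j)"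
  using assms by (auto simp: scalar_prod_def lessThan_atLeast0 intro!: sum.cong)

text \<open>The Rayleigh maximum \<mu> lies in the spectrum, hence is at most its
  \<open>Max\<close>; since \<mu> is nonnegative, the comparison survives squaring. Nonemptiness is
  recorded because \<open>Max\<close> is meaningless without it.\<close>

lemma norm_le_Max_spectrum_of_nonneg_symmetric:
  fixes A :: "real mat"
  assumes A: "A \<in> carrier_mat n n" and "0 < n"
    and sym: "\<And>i j. i < n \<Longrightarrow> j < n \<Longrightarrow> A $$ (i, j) = A $$ (j, i)"
    and nonneg: "\<And>i j. i < n \<Longrightarrow> j < n \<Longrightarrow> 0 \<le> A $$ (i, j)"
  shows "spectrum A \<noteq> {}" "0 \<le> Max (spectrum A)"
    and "(\<Sum>i<n. (\<Sum>j<n. A $$ (i, j) * y j)\<^sup>2) \<le> (Max (spectrum A))\<^sup>2 * (\<Sum>i<n. (y i)\<^sup>2)"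
proof -
  have ne: "{..<n} \<noteq> {}"
    using \<open>0 < n\<close> by (simp add: lessThan_empty_iff)
  have sym': "A $$ (i, j) = A $$ (j, i)" and nonneg': "0 \<le> A $$ (i, j)"
    if "i \<in> {..<n}" "j \<in> {..<n}" for i j
    using that sym nonneg by simp_all
  obtain x \<mu> where Nx: "(\<Sum>i<n. (x i)\<^sup>2) = 1" and \<mu>: "0 \<le> \<mu>"
    and eig: "\<And>i. i \<in> {..<n} \<Longrightarrow> (\<Sum>j<n. A $$ (i, j) * x j) = \<mu> * x i"
    and le: "\<And>y. (\<Sum>i<n. (\<Sum>j<n. A $$ (i, j) * y j)\<^sup>2) \<le> \<mu>\<^sup>2 * (\<Sum>i<n. (y i)\<^sup>2)"
    using nonneg_symmetric_norm_bound_eigenvector[of "{..<n}" "\<lambda>i j. A $$ (i, j)",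
        OF finite_lessThan ne sym' nonneg'] by blast
  have "A *\<^sub>v vec n x = \<mu> \<cdot>\<^sub>v vec n x"
  proof (rule eq_vecI)
    fix i assume "i < dim_vec (\<mu> \<cdot>\<^sub>v vec n x)"
    then have i: "i < n" by simp
    show "(A *\<^sub>v vec n x) $ i = (\<mu> \<cdot>\<^sub>v vec n x) $ i"
      unfolding mult_mat_vec_index_sum[OF A i] using eig i by simp
  qed (use A in simp)
  moreover have "vec n x \<noteq> 0\<^sub>v n"
  proof
    assume "vec n x = 0\<^sub>v n"
    then have "x i = 0" if "i < n" for i
      using that by (metis index_vec index_zero_vec(1))
    then show False using Nx by simp
  qed
  ultimately have \<mu>_in: "\<mu> \<in> spectrum A"
    using A by (auto simp: spectrum_def eigenvalue_def eigenvector_def intro!: exI[of _ "vec n x"])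
  then show "spectrum A \<noteq> {}" by blast
  have \<mu>_le: "\<mu> \<le> Max (spectrum A)"
    using \<mu>_in card_finite_spectrum(1)[OF A] by simp
  with \<mu> show "0 \<le> Max (spectrum A)" by simp
  show "(\<Sum>i<n. (\<Sum>j<n. A $$ (i, j) * y j)\<^sup>2) \<le> (Max (spectrum A))\<^sup>2 * (\<Sum>i<n. (y i)\<^sup>2)"
    using \<mu> \<mu>_le
    by (intro order_trans[OF le] mult_right_mono power_mono sum_nonneg) auto
qed

text \<open>Compare both sides of the eigenvector equation at a coordinate of largest modulus: there
  every other coordinate can be replaced by the largest one, and the row sum factors out.\<close>

lemma eigenvalue_le_row_sum:
  fixes A :: "real mat"
  assumes A: "A \<in> carrier_mat n n"
    and nonneg: "\<And>i j. i < n \<Longrightarrow> j < n \<Longrightarrow> 0 \<le> A $$ (i, j)"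
    and row: "\<And>i. i < n \<Longrightarrow> (\<Sum>j<n. A $$ (i, j)) \<le> r"
    and "l \<in> spectrum A"
  shows "l \<le> r"
proof -
  obtain v where v: "v \<in> carrier_vec n" "v \<noteq> 0\<^sub>v n" "A *\<^sub>v v = l \<cdot>\<^sub>v v"
    using assms by (auto simp: spectrum_def eigenvalue_def eigenvector_def)
  \<comment> \<open>A nonzero coordinate makes the largest modulus positive, so that it can be
    cancelled at the end.\<close>
  obtain k where k: "k < n" "v $ k \<noteq> 0"
    using v by (metis carrier_vecD eq_vecI index_zero_vec)
  let ?M = "(\<lambda>i. \<bar>v $ i\<bar>) ` {..<n}"
  have "Max ?M \<in> ?M"
    using k by (intro Max_in) auto
  then obtain i where i: "i < n" "\<bar>v $ i\<bar> = Max ?M"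
    by auto
  have max: "\<bar>v $ j\<bar> \<le> \<bar>v $ i\<bar>" if "j < n" for j
    unfolding i(2) using that by (intro Max_ge) auto
  have pos: "0 < \<bar>v $ i\<bar>"
    using max[OF k(1)] k(2) by linarith
  have "vec n (($) v) = v"
    using v(1) by auto
  then have "(\<Sum>j<n. A $$ (i, j) * v $ j) = l * v $ i"
    using mult_mat_vec_index_sum[OF A i(1), of "($) v"] v i(1) by simp
  then have "\<bar>l\<bar> * \<bar>v $ i\<bar> = \<bar>\<Sum>j<n. A $$ (i, j) * v $ j\<bar>"
    by (simp add: abs_mult)
  also have "\<dots> \<le> (\<Sum>j<n. A $$ (i, j) * \<bar>v $ i\<bar>)"
    using nonneg max i(1)
    by (intro order_trans[OF sum_abs] sum_mono) (simp add: abs_mult mult_left_mono)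
  also have "\<dots> \<le> r * \<bar>v $ i\<bar>"
    unfolding sum_distrib_right[symmetric] using row i(1) by (intro mult_right_mono) auto
  finally have "\<bar>l\<bar> \<le> r"
    using pos by simp
  then show ?thesis by linarith
qed

section \<open>Row sums of the self-loop adjacency matrix\<close>

lemma vdeg_eq_card: "vdeg G v = card {u. (v, u) \<in> parcs G}"
proof -
  have "out_arcs (with_proj G) v = Pair v ` {u. (v, u) \<in> parcs G}"
    by (auto simp: out_arcs_def)
  then show ?thesis
    by (simp add: vdeg_def out_degree_def card_image inj_on_def)
qed

lemma self_loop_adj_mat_index:
  assumes "i < length vs" "j < length vs"
  shows "self_loop_adj_mat vs G S $$ (i, j)
    = of_bool ((vs ! i, vs ! j) \<in> parcs G) + of_bool (i = j \<and> vs ! i \<in> S)"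
  using assms by (auto simp: self_loop_adj_mat_def adj_mat_def loop_mat_def)

lemma self_loop_adj_mat_carrier: "self_loop_adj_mat vs G S \<in> carrier_mat (length vs) (length vs)"
  by (simp add: self_loop_adj_mat_def adj_mat_def loop_mat_def)

lemma sum_nth_distinct:
  assumes "distinct vs"
  shows "(\<Sum>i<length vs. f (vs ! i)) = sum f (set vs)"
  using assms by (intro sum.reindex_bij_betw bij_betw_nth) auto

text \<open>These are the entries of the matrix applied to the all-ones vector; they feed both the
  lower and the upper estimate of \<open>lambda1\<close>.\<close>

lemma self_loop_adj_mat_row_sum:
  assumes "pair_graph G" "distinct vs" "set vs = pverts G" "i < length vs"
  shows "(\<Sum>j<length vs. self_loop_adj_mat vs G S $$ (i, j))
    = real (vdeg G (vs ! i)) + of_bool (vs ! i \<in> S)"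
proof -
  interpret pair_graph G by fact
  have "(\<Sum>j<length vs. self_loop_adj_mat vs G S $$ (i, j))
    = (\<Sum>j<length vs. of_bool ((vs ! i, vs ! j) \<in> parcs G)) + (\<Sum>j<length vs. of_bool (i = j \<and> vs ! i \<in> S))"
    using assms(4) by (simp add: self_loop_adj_mat_index sum.distrib)
  also have "(\<Sum>j<length vs. of_bool ((vs ! i, vs ! j) \<in> parcs G))
      = (\<Sum>u\<in>pverts G. of_bool ((vs ! i, u) \<in> parcs G) :: real)"
    unfolding assms(3)[symmetric]
    by (rule sum_nth_distinct[OF assms(2), where f = "\<lambda>u. of_bool ((vs ! i, u) \<in> parcs G)"])
  also have "\<dots> = real (card (pverts G \<inter> {u. (vs ! i, u) \<in> parcs G}))"
    by (simp add: of_bool_def sum.If_cases)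
  also have "pverts G \<inter> {u. (vs ! i, u) \<in> parcs G} = {u. (vs ! i, u) \<in> parcs G}"
    by (auto dest: arc_snd_in_verts)
  also have "(\<Sum>j<length vs. of_bool (i = j \<and> vs ! i \<in> S)) = (of_bool (vs ! i \<in> S) :: real)"
    using assms(4) by (cases "vs ! i \<in> S") (simp_all add: of_bool_def)
  finally show ?thesis
    by (simp add: vdeg_eq_card)
qed

lemma self_loop_adj_mat_sym:
  assumes "pair_graph G" "i < length vs" "j < length vs"
  shows "self_loop_adj_mat vs G S $$ (i, j) = self_loop_adj_mat vs G S $$ (j, i)"
proof -
  interpret pair_graph G by fact
  have "(u, v) \<in> parcs G \<longleftrightarrow> (v, u) \<in> parcs G" for u v
    using arcs_symmetric by blast
  with assms(2,3) show ?thesis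
    by (auto simp: self_loop_adj_mat_index)
qed

text \<open>Collects what is used about \<open>lambda1\<close> in terms of vertices, so that
  matrices and the enumeration \<open>vs\<close> no longer occur in the arguments that
  follow.\<close>

lemma
  assumes "pair_graph G" "pverts G \<noteq> {}" "distinct vs" "set vs = pverts G"
  shows lambda1_nonneg: "0 \<le> lambda1 vs G S"
    and lambda1_power2_ge: "(\<Sum>v\<in>pverts G. (real (vdeg G v) + of_bool (v \<in> S))\<^sup>2)
      \<le> (lambda1 vs G S)\<^sup>2 * real (card (pverts G))"
    and lambda1_le_max_row_sum: "\<lbrakk>\<And>v. v \<in> pverts G \<Longrightarrow> real (vdeg G v) + of_bool (v \<in> S) \<le> r\<rbrakk>
      \<Longrightarrow> lambda1 vs G S \<le> r"
proof -
  let ?A = "self_loop_adj_mat vs G S"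
  have pos: "0 < length vs"
    using assms by auto
  have n: "card (pverts G) = length vs"
    using assms distinct_card by metis
  note A = self_loop_adj_mat_carrier[of vs G S]
  note sym = self_loop_adj_mat_sym[OF assms(1), of _ vs _ S]
  have nonneg: "0 \<le> ?A $$ (i, j)" if "i < length vs" "j < length vs" for i j
    using that by (simp add: self_loop_adj_mat_index)
  note bnd = norm_le_Max_spectrum_of_nonneg_symmetric[OF A pos sym nonneg]
  show "0 \<le> lambda1 vs G S"
    unfolding lambda1_def by (rule bnd(2))
  have "(\<Sum>v\<in>pverts G. (real (vdeg G v) + of_bool (v \<in> S))\<^sup>2)
      = (\<Sum>i<length vs. (real (vdeg G (vs ! i)) + of_bool (vs ! i \<in> S))\<^sup>2)"
    unfolding assms(4)[symmetric]
    by (rule sum_nth_distinct[OF assms(3), symmetric])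
  \<comment> \<open>The factor 1 exhibits the all-ones vector to which the norm bound is
    applied.\<close>
  also have "\<dots> = (\<Sum>i<length vs. (\<Sum>j<length vs. ?A $$ (i, j) * 1)\<^sup>2)"
    by (simp add: self_loop_adj_mat_row_sum[OF assms(1,3,4)])
  also have "\<dots> \<le> (lambda1 vs G S)\<^sup>2 * (\<Sum>i<length vs. 1\<^sup>2)"
    unfolding lambda1_def by (rule bnd(3))
  finally show "(\<Sum>v\<in>pverts G. (real (vdeg G v) + of_bool (v \<in> S))\<^sup>2)
      \<le> (lambda1 vs G S)\<^sup>2 * real (card (pverts G))"
    by (simp add: n)
  assume r: "\<And>v. v \<in> pverts G \<Longrightarrow> real (vdeg G v) + of_bool (v \<in> S) \<le> r"
  have "(\<Sum>j<length vs. ?A $$ (i, j)) \<le> r" if "i < length vs" for i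
    using that assms(4) nth_mem[OF that] by (simp add: self_loop_adj_mat_row_sum[OF assms(1,3,4)] r)
  then have "l \<le> r" if "l \<in> spectrum ?A" for l
    using eigenvalue_le_row_sum[OF A nonneg] that by blast
  then show "lambda1 vs G S \<le> r"
    unfolding lambda1_def using bnd(1) card_finite_spectrum(1)[OF A] by simp
qed

section \<open>The bound and a criterion for equality\<close>

text \<open>A loop raises the square of a degree \<open>d\<close> to that of \<open>d + 1\<close>, a
  gain of \<open>2 * d + 1\<close>, and only vertices of \<open>S\<close> have one.\<close>

lemma sum_power2_row_sums:
  assumes "finite V" "S \<subseteq> V"
  shows "(\<Sum>v\<in>V. (real (d v) + of_bool (v \<in> S))\<^sup>2)
    = real (\<Sum>v\<in>V. (d v)\<^sup>2) + (\<Sum>v\<in>S. 2 * real (d v) + 1)"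
proof -
  have "(\<Sum>v\<in>V. (real (d v) + of_bool (v \<in> S))\<^sup>2)
      = (\<Sum>v\<in>V. (real (d v))\<^sup>2 + (if v \<in> S then 2 * real (d v) + 1 else 0))"
    by (intro sum.cong) (auto simp: power2_eq_square algebra_simps)
  also have "\<dots> = real (\<Sum>v\<in>V. (d v)\<^sup>2) + (\<Sum>v\<in>V \<inter> S. 2 * real (d v) + 1)"
    using assms(1) by (simp add: sum.distrib sum.If_cases Int_def)
  also have "V \<inter> S = S"
    using assms(2) by blast
  finally show ?thesis .
qed

lemma lambda1_lower_bound:
  assumes "pair_graph G" "pverts G \<noteq> {}" "distinct vs" "set vs = pverts G" "S \<subseteq> pverts G"
  shows "sqrt (real (first_zagreb G) / real (card (pverts G))
      + real (card S) / real (card (pverts G)) * (2 * real (min_degree G) + 1)) \<le> lambda1 vs G S"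
proof (rule real_le_lsqrt)
  have fin: "finite (pverts G)" using assms(4) by (metis finite_set)
  have pos: "0 < real (card (pverts G))" using fin assms(2) by (simp add: card_gt_0_iff)
  have "min_degree G \<le> vdeg G v" if "v \<in> S" for v
    unfolding min_degree_def using that assms(5) fin by (intro Min_le) auto
  then have "(\<Sum>v\<in>S. 2 * real (min_degree G) + 1) \<le> (\<Sum>v\<in>S. 2 * real (vdeg G v) + 1)"
    by (intro sum_mono) simp
  then have "real (first_zagreb G) + real (card S) * (2 * real (min_degree G) + 1)
      \<le> (lambda1 vs G S)\<^sup>2 * real (card (pverts G))"
    using lambda1_power2_ge[OF assms(1-4), of S] sum_power2_row_sums[OF fin assms(5), of "vdeg G"]
    by (simp add: first_zagreb_def)
  then show "real (first_zagreb G) / real (card (pverts G))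
      + real (card S) / real (card (pverts G)) * (2 * real (min_degree G) + 1) \<le> (lambda1 vs G S)\<^sup>2"
    using pos by (simp add: field_simps)
  show "0 \<le> lambda1 vs G S"
    by (rule lambda1_nonneg[OF assms(1-4)])
qed

text \<open>Covers both equality cases: a constant row sum makes the radicand
  \<open>r\<^sup>2\<close>, and the largest row sum caps \<open>lambda1\<close> at the same
  \<open>r\<close>.\<close>

lemma lambda1_eq_of_constant_row_sum:
  assumes "pair_graph G" "pverts G \<noteq> {}" "distinct vs" "set vs = pverts G" "S \<subseteq> pverts G"
    and row: "\<And>v. v \<in> pverts G \<Longrightarrow> vdeg G v + of_bool (v \<in> S) = r"
  shows "lambda1 vs G S = sqrt (real (first_zagreb G) / real (card (pverts G))
      + real (card S) / real (card (pverts G)) * (2 * real (min_degree G) + 1))" (is "_ = sqrt ?R")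
proof (rule antisym)
  have fin: "finite (pverts G)" using assms(4) by (metis finite_set)
  have pos: "0 < real (card (pverts G))" using fin assms(2) by (simp add: card_gt_0_iff)
  have row': "real (vdeg G v) + of_bool (v \<in> S) = real r" if "v \<in> pverts G" for v
    using row[OF that] by (metis of_nat_add of_nat_of_bool)
  have min: "vdeg G v = min_degree G" if "v \<in> S" for v
  proof -
    \<comment> \<open>A looped vertex has degree one less than \<open>r\<close>, an unlooped one
      degree \<open>r\<close>; so looped vertices attain the minimum.\<close>
    have "vdeg G v \<le> vdeg G w" if "w \<in> pverts G" for w
      using row[OF that] row[of v] \<open>v \<in> S\<close> assms(5) by (cases "w \<in> S") auto
    then show ?thesis
      unfolding min_degree_def using that assms(5) fin by (intro Min_eqI[symmetric]) auto
  qed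
  have "real (card (pverts G)) * (real r)\<^sup>2
      = (\<Sum>v\<in>pverts G. (real (vdeg G v) + of_bool (v \<in> S))\<^sup>2)"
    by (simp add: row')
  also have "\<dots> = real (first_zagreb G) + real (card S) * (2 * real (min_degree G) + 1)"
    unfolding sum_power2_row_sums[OF fin assms(5)] by (simp add: first_zagreb_def min)
  finally have "?R = (real r)\<^sup>2"
    using pos by (simp add: field_simps)
  moreover have "lambda1 vs G S \<le> real r"
    using row' by (intro lambda1_le_max_row_sum[OF assms(1-4)]) simp
  ultimately show "lambda1 vs G S \<le> sqrt ?R"
    by simp
qed (rule lambda1_lower_bound[OF assms(1-5)])

section \<open>Graphs isomorphic to a looped complete graph\<close>

text \<open>The images of \<open>u\<close> and \<open>v\<close>, equal or not, are joined by an arc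
  of the target. Its preimage is an arc of \<open>H\<close>, whose ends are \<open>u\<close> and
  \<open>v\<close> by injectivity on vertices.\<close>

lemma iso_looped_complete_graph_arcs:
  assumes "digraph_iso (with_proj H) (with_proj (looped_complete_graph n))"
    and "u \<in> pverts H" "v \<in> pverts H"
  shows "(u, v) \<in> parcs H"
proof -
  obtain f where f: "pre_digraph.digraph_isomorphism (with_proj H) f"
    and eq: "with_proj (looped_complete_graph n) = app_iso f (with_proj H)"
    using assms(1) by (auto simp: digraph_iso_def)
  have verts: "iso_verts f ` pverts H = {..<n}"
    using arg_cong[OF eq, of verts]
    by (simp add: verts_app_iso looped_complete_graph_def complete_graph_def self_loop_graph_def)
  \<comment> \<open>Both graphs read off the ends of an arc by projection, so the isomorphism acts
    on arcs through its action on their ends.\<close>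
  have tl: "iso_tail f = fst" and hd: "iso_head f = snd"
    using arg_cong[OF eq, of tail] arg_cong[OF eq, of head]
    by (simp_all add: tail_app_iso head_app_iso)
  have "(iso_verts f u, iso_verts f v) \<in> arcs (with_proj (looped_complete_graph n))"
    using verts assms(2,3)
    by (auto simp: looped_complete_graph_def complete_graph_def self_loop_graph_def)
  then obtain x y where e: "(x, y) \<in> parcs H" "iso_arcs f (x, y) = (iso_verts f u, iso_verts f v)"
    unfolding eq by (auto simp: arcs_app_iso)
  have wf: "wf_digraph (with_proj H)" and inj: "inj_on (iso_verts f) (pverts H)"
    and "iso_verts f x = iso_verts f u" "iso_verts f y = iso_verts f v"
    using f e by (auto simp: pre_digraph.digraph_isomorphism_def tl hd)
  moreover have "x \<in> pverts H" "y \<in> pverts H"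
    using wf_digraph.tail_in_verts[OF wf, of "(x, y)"] wf_digraph.head_in_verts[OF wf, of "(x, y)"] e
    by auto
  ultimately have "x = u" "y = v"
    using assms(2,3) by (auto dest: inj_onD)
  with e show ?thesis by simp
qed

lemma iso_looped_complete_graph_row_sum:
  assumes "pair_graph G" "S \<subseteq> pverts G"
    and iso: "digraph_iso (with_proj (self_loop_graph G S)) (with_proj (looped_complete_graph n))"
    and v: "v \<in> pverts G"
  shows "vdeg G v + of_bool (v \<in> S) = card (pverts G)"
proof -
  interpret pair_graph G by fact
  have arc: "(u, w) \<in> parcs G \<or> u = w \<and> u \<in> S" if "u \<in> pverts G" "w \<in> pverts G" for u w
    using iso_looped_complete_graph_arcs[OF iso, of u w] that by (auto simp: self_loop_graph_def)
  have noloop: "(u, u) \<notin> parcs G" for u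
    using pair_no_loops by force
  \<comment> \<open>The diagonal pair is an arc, and in a loop-free \<open>G\<close> it can only
    come from \<open>S\<close>.\<close>
  have "v \<in> S" using arc[OF v v] noloop by blast
  moreover have "{u. (v, u) \<in> parcs G} = pverts G - {v}"
    using arc[OF v] noloop by (auto dest: arc_snd_in_verts)
  \<comment> \<open>Guards the truncated subtraction in the degree
    \<open>card (pverts G) - 1\<close>.\<close>
  moreover have "0 < card (pverts G)"
    using v by (auto simp: card_gt_0_iff)
  ultimately show ?thesis
    using v by (simp add: vdeg_eq_card)
qed

theorem theorem4p9:
  fixes G :: "'a pair_pre_digraph" and S :: "'a set" and vs :: "'a list" and n m \<sigma> :: nat
  assumes "pair_graph G"
    and "S \<subseteq> pverts G"
    and "connected (with_proj (self_loop_graph G S))"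
    and "card (pverts G) = n"
    and "num_edges G = m"
    and "card S = \<sigma>"
    and "distinct vs" and "set vs = pverts G"
  shows "lambda1 vs G S \<ge>
           sqrt (real (first_zagreb G) / real n
                 + real \<sigma> / real n * (2 * real (min_degree G) + 1))
    \<and> (digraph_iso (with_proj (self_loop_graph G S)) (with_proj (looped_complete_graph n)) \<longrightarrow>
         lambda1 vs G S =
           sqrt (real (first_zagreb G) / real n
                 + real \<sigma> / real n * (2 * real (min_degree G) + 1)))
    \<and> (\<forall>k. semiregular k (k + 1) G
           \<and> (\<forall>v\<in>pverts G. (v \<in> S \<longrightarrow> vdeg G v = k) \<and> (v \<notin> S \<longrightarrow> vdeg G v = k + 1)) \<longrightarrow>
         lambda1 vs G S =
           sqrt (real (first_zagreb G) / real n
                 + real \<sigma> / real n * (2 * real (min_degree G) + 1)))"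
proof (intro conjI impI allI)
  \<comment> \<open>Connectedness includes having a vertex, which makes the division by
    \<open>n\<close> and the minimum degree meaningful.\<close>
  have ne: "pverts G \<noteq> {}"
    using assms(3) by (auto simp: connected_def strongly_connected_def mk_symmetric_def self_loop_graph_def)
  note eq = lambda1_eq_of_constant_row_sum[OF assms(1) ne assms(7,8,2), unfolded assms(4,6)]
  show "sqrt (real (first_zagreb G) / real n
      + real \<sigma> / real n * (2 * real (min_degree G) + 1)) \<le> lambda1 vs G S"
    using lambda1_lower_bound[OF assms(1) ne assms(7,8,2)] unfolding assms(4,6) .
  show "lambda1 vs G S = sqrt (real (first_zagreb G) / real n
      + real \<sigma> / real n * (2 * real (min_degree G) + 1))"
    if "digraph_iso (with_proj (self_loop_graph G S)) (with_proj (looped_complete_graph n))"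
    by (rule eq) (rule iso_looped_complete_graph_row_sum[OF assms(1,2) that])
  show "lambda1 vs G S = sqrt (real (first_zagreb G) / real n
      + real \<sigma> / real n * (2 * real (min_degree G) + 1))"
    if "semiregular k (k + 1) G
      \<and> (\<forall>v\<in>pverts G. (v \<in> S \<longrightarrow> vdeg G v = k) \<and> (v \<notin> S \<longrightarrow> vdeg G v = k + 1))" for k
    \<comment> \<open>The loop makes up for the one degree that vertices of \<open>S\<close>
      lack.\<close>
    using that by (intro eq[where r = "k + 1"]) auto
qed

end
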